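(* Let $X$, $B_{ss}\subseteq B_s\subseteq B_w$, $V_s^0$, the operators $\mathcal{L}_\epsilon$ ($\epsilon\ge 0$), $\mathcal{L}=\mathcal{L}_0$, and the fixed probability measures $h_\epsilon$, $h=h_0$ be as described in the context. Suppose that: (1) the norms $\|\mathcal{L}^{k}\|_{B_w\to B_w}$ and $\|\mathcal{L}_\epsilon^{k}\|_{B_w\to B_w}$ are uniformly bounded with respect to $k$ and $\epsilon>0$; (2) there is a constant $C$ such that $\|\mathcal{L}_\epsilon-\mathcal{L}\|_{B_s\to B_w}\le C\epsilon$; (3) the operators $\mathcal{L}_\epsilon$, $\epsilon\ge 0$, have a uniform rate of contraction on $V_s^0$: there are $C_1>0$ and $0<\rho<1$ (independent of $\epsilon$ and $n$) such that $\|\mathcal{L}_\epsilon^{n}\|_{V_s^0\to B_s}\le C_1\rho^{n}$; (4) there is an operator $\hat{\mathcal{L}}:B_{ss}\to B_s$ such that $$\lim_{\epsilon\to 0}\big\|\epsilon^{-1}(\mathcal{L}_\epsilon-\mathcal{L})h-\hat{\mathcal{L}}h\big\|_s=0 .$$ Let $\hat h=(\mathrm{Id}-\mathcal{L})^{-1}\hat{\mathcal{L}}h$. Then $$\lim_{\epsilon\to 0}\big\|\epsilon^{-1}(h_\epsilon-h)-\hat h\big\|_w=0 .$$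
   Context: $X$ is a compact manifold with boundary. $B_{ss}\subseteq B_s\subseteq B_w$ are three Banach spaces which are subspaces of the space of finite signed Borel measures on $X$, equipped with norms $\|\cdot\|_{ss},\|\cdot\|_s,\|\cdot\|_w$ respectively, such that $\|\cdot\|_w\le\|\cdot\|_s\le\|\cdot\|_{ss}$ (each inequality where both norms are defined). For $\epsilon\ge 0$, $\mathcal{L}_\epsilon$ is a positive linear operator on finite signed Borel measures, acting on each of the spaces $B_{ss}, B_s, B_w$, which maps probability measures to probability measures (so it preserves total mass) and has a unique fixed probability measure $h_\epsilon$, with $h_\epsilon\in B_{ss}$. Write $\mathcal{L}:=\mathcal{L}_0$ (the unperturbed operator) and $h:=h_0\in B_{ss}$ for its fixed probability measure. $V_s^0=\{v\in B_s: v(X)=0\}$ and $V_w^0=\{v\in B_w: v(X)=0\}$; it is assumed that $V_s^0$ is closed in $B_s$. $(\mathrm{Id}-\mathcal{L})^{-1}$ denotes the inverse of $\mathrm{Id}-\mathcal{L}$ on $V_s^0$; under assumption (3) it is given by $\sum_{k\ge0}\mathcal{L}^k$. The element $\hat{\mathcal{L}}h$ lies in $V_s^0$. *)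

theory Defs
  imports "HOL-Analysis.Analysis"
begin

section \<open>Compact manifolds with boundary\<close>

text \<open>
  Topological manifolds; the boundary may be empty. The local model is the half-space
  \<open>y\<^sub>0 \<ge> 0\<close> of \<open>n\<close>-dimensional Euclidean space, whose points are the functions
  \<open>nat \<Rightarrow> real\<close> vanishing from index \<open>n\<close> on. For \<open>n = 0\<close> the model is a single point.
\<close>

definition half_space :: "nat \<Rightarrow> (nat \<Rightarrow> real) topology" where
  "half_space n = subtopology (Euclidean_space n) {y. 0 \<le> y 0}"

definition compact_manifold_with_boundary :: "'a topology \<Rightarrow> bool" where
  "compact_manifold_with_boundary X \<longleftrightarrow>
     compact_space X \<and> Hausdorff_space X \<and> second_countable X \<and>
     (\<exists>n. \<forall>x \<in> topspace X. \<exists>U V. openin X U \<and> x \<in> U \<and> openin (half_space n) V \<and>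
        subtopology X U homeomorphic_space subtopology (half_space n) V)"

section \<open>Finite signed Borel measures\<close>

text \<open>
  Countably additive real-valued set functions on the Borel sets. To make equality of measures
  agree with equality of functions, they take the value 0 on non-Borel sets. Countable additivity
  applied to the constant family of empty sets forces the value 0 on the empty set.
\<close>

typedef (overloaded) 'a signed_measure =
  "{\<mu> :: 'a::topological_space set \<Rightarrow> real.
      (\<forall>A. A \<notin> sets borel \<longrightarrow> \<mu> A = 0) \<and>
      (\<forall>A :: nat \<Rightarrow> 'a set. range A \<subseteq> sets borel \<longrightarrow> disjoint_family A \<longrightarrow>
         (\<lambda>n. \<mu> (A n)) sums \<mu> (\<Union>n. A n))}"
  morphisms smeasure Abs_signed_measure
proof
  show "(\<lambda>_. 0) \<in> {\<mu> :: 'a::topological_space set \<Rightarrow> real.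
      (\<forall>A. A \<notin> sets borel \<longrightarrow> \<mu> A = 0) \<and>
      (\<forall>A :: nat \<Rightarrow> 'a set. range A \<subseteq> sets borel \<longrightarrow> disjoint_family A \<longrightarrow>
         (\<lambda>n. \<mu> (A n)) sums \<mu> (\<Union>n. A n))}"
    by simp
qed

setup_lifting type_definition_signed_measure

instantiation signed_measure :: (topological_space) real_vector
begin

lift_definition zero_signed_measure :: "'a signed_measure" is "\<lambda>A. 0"
  by simp

lift_definition plus_signed_measure ::
    "'a signed_measure \<Rightarrow> 'a signed_measure \<Rightarrow> 'a signed_measure" is
  "\<lambda>\<mu> \<nu> A. \<mu> A + \<nu> A"
  by (simp add: sums_add)

lift_definition uminus_signed_measure :: "'a signed_measure \<Rightarrow> 'a signed_measure" is
  "\<lambda>\<mu> A. - \<mu> A"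
  by (simp add: sums_minus)

lift_definition minus_signed_measure ::
    "'a signed_measure \<Rightarrow> 'a signed_measure \<Rightarrow> 'a signed_measure" is
  "\<lambda>\<mu> \<nu> A. \<mu> A - \<nu> A"
  by (simp add: sums_diff)

lift_definition scaleR_signed_measure :: "real \<Rightarrow> 'a signed_measure \<Rightarrow> 'a signed_measure" is
  "\<lambda>c \<mu> A. c * \<mu> A"
  by (simp add: sums_mult)

instance
  by standard (transfer; simp add: fun_eq_iff algebra_simps)+

end

definition positive_measure :: "'a::topological_space signed_measure \<Rightarrow> bool" where
  "positive_measure \<mu> \<longleftrightarrow> (\<forall>A \<in> sets borel. 0 \<le> smeasure \<mu> A)"

definition probability_measure :: "'a::topological_space signed_measure \<Rightarrow> bool" where
  "probability_measure \<mu> \<longleftrightarrow> positive_measure \<mu> \<and> smeasure \<mu> UNIV = 1"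

definition zero_mass :: "'a::topological_space signed_measure set \<Rightarrow> 'a signed_measure set" where
  "zero_mass B = {v \<in> B. smeasure v UNIV = 0}"

section \<open>Norms on linear subspaces\<close>

text \<open>
  A norm on a subspace \<open>B\<close> is a function on the whole type of which only the values on \<open>B\<close> matter.
\<close>

definition norm_on :: "'v::real_vector set \<Rightarrow> ('v \<Rightarrow> real) \<Rightarrow> bool" where
  "norm_on B N \<longleftrightarrow> subspace B \<and>
     (\<forall>x\<in>B. 0 \<le> N x) \<and> (\<forall>x\<in>B. N x = 0 \<longleftrightarrow> x = 0) \<and>
     (\<forall>x\<in>B. \<forall>c. N (c *\<^sub>R x) = \<bar>c\<bar> * N x) \<and>
     (\<forall>x\<in>B. \<forall>y\<in>B. N (x + y) \<le> N x + N y)"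

text \<open>
  The value 0 outside \<open>B\<close> is there because \<^locale>\<open>Metric_space\<close> requires nonnegativity and
  symmetry of the distance on the whole type.
\<close>

definition norm_dist :: "'v::real_vector set \<Rightarrow> ('v \<Rightarrow> real) \<Rightarrow> 'v \<Rightarrow> 'v \<Rightarrow> real" where
  "norm_dist B N x y = (if x \<in> B \<and> y \<in> B then N (x - y) else 0)"

lemma Metric_space_norm_dist:
  assumes "norm_on B N"
  shows "Metric_space B (norm_dist B N)"
proof -
  have "subspace B" and nonneg: "\<And>x. x \<in> B \<Longrightarrow> 0 \<le> N x"
    and zero: "\<And>x. x \<in> B \<Longrightarrow> N x = 0 \<longleftrightarrow> x = 0"
    and scale: "\<And>x c. x \<in> B \<Longrightarrow> N (c *\<^sub>R x) = \<bar>c\<bar> * N x"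
    and add: "\<And>x y. x \<in> B \<Longrightarrow> y \<in> B \<Longrightarrow> N (x + y) \<le> N x + N y"
    using assms by (simp_all add: norm_on_def)
  have sub: "x - y \<in> B" if "x \<in> B" "y \<in> B" for x y
    using \<open>subspace B\<close> that by (rule subspace_diff)
  show ?thesis
  proof
    show "0 \<le> norm_dist B N x y" for x y
      by (simp add: norm_dist_def nonneg sub)
    show "norm_dist B N x y = norm_dist B N y x" for x y
    proof (cases "x \<in> B \<and> y \<in> B")
      case True
      then have "N ((-1) *\<^sub>R (x - y)) = \<bar>-1\<bar> * N (x - y)"
        by (intro scale sub) auto
      moreover have "(-1) *\<^sub>R (x - y) = y - x"
        by simp
      ultimately have "N (y - x) = N (x - y)"
        by (metis abs_minus_cancel abs_one mult_1)
      with True show ?thesis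
        unfolding norm_dist_def by presburger
    next
      case False
      then show ?thesis
        unfolding norm_dist_def by presburger
    qed
    show "norm_dist B N x y = 0 \<longleftrightarrow> x = y" if "x \<in> B" "y \<in> B" for x y
      using that zero[OF sub[OF that]] by (simp add: norm_dist_def)
    show "norm_dist B N x z \<le> norm_dist B N x y + norm_dist B N y z"
      if "x \<in> B" "y \<in> B" "z \<in> B" for x y z
      using that add[OF sub[of x y] sub[of y z]] by (simp add: norm_dist_def)
  qed
qed

definition banach_on :: "'v::real_vector set \<Rightarrow> ('v \<Rightarrow> real) \<Rightarrow> bool" where
  "banach_on B N \<longleftrightarrow> norm_on B N \<and> Metric_space.mcomplete B (norm_dist B N)"

definition closed_in_norm :: "'v::real_vector set \<Rightarrow> ('v \<Rightarrow> real) \<Rightarrow> 'v set \<Rightarrow> bool" where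
  "closed_in_norm B N S \<longleftrightarrow> closedin (Metric_space.mtopology B (norm_dist B N)) S"

text \<open>
  Norm of \<open>T\<close> as an operator from \<open>E\<close> with norm \<open>p\<close> to a space with norm \<open>q\<close>; it is infinite
  if \<open>T\<close> is unbounded.
\<close>

definition op_norm ::
    "'v set \<Rightarrow> ('v \<Rightarrow> real) \<Rightarrow> ('w \<Rightarrow> real) \<Rightarrow> ('v \<Rightarrow> 'w) \<Rightarrow> ereal" where
  "op_norm E p q T = (SUP v \<in> {v \<in> E. p v \<le> 1}. ereal (q (T v)))"

end

theory Submission
  imports Defs
begin

text \<open>
  Put \<open>d\<^sub>\<epsilon> = (h\<^sub>\<epsilon> - h) / \<epsilon> - hhat\<close>. Since \<open>h\<^sub>\<epsilon>\<close> and \<open>h\<close> are fixed points and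
  \<open>(Id - L\<^sub>0) hhat = Lhat h\<close>,
  \<open>(Id - L\<^sub>\<epsilon>) d\<^sub>\<epsilon> = ((L\<^sub>\<epsilon> - L\<^sub>0) h / \<epsilon> - Lhat h) + (L\<^sub>\<epsilon> - L\<^sub>0) hhat\<close>.
  The first summand tends to zero strongly because \<open>Lhat h\<close> is the derivative of \<open>L\<^sub>\<epsilon> h\<close>. Of
  the second one only weak smallness is known, with a bound in the strong norm. So
  \<open>(Id - L\<^sub>\<epsilon>)\<^sup>-\<^sup>1\<close> has to be controlled, uniformly in \<open>\<epsilon>\<close>, on vectors that are strongly bounded
  and weakly small. Splitting
  \<open>d = (\<Sum>k<n. L\<^sub>\<epsilon>\<^sup>k (d - L\<^sub>\<epsilon> d)) + L\<^sub>\<epsilon>\<^sup>n d\<close>, the finite sum is weakly small by power boundedness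
  on the weak space, and the remainder is strongly small for large \<open>n\<close> by the contraction on zero
  mass measures (lemma \<open>weak_resolvent_bound\<close>).

  Two points have to be settled before this makes sense. The operators preserve zero mass, because
  of the contraction and a fixed point of nonzero mass (lemma \<open>invariant_of_decay\<close>). And
  \<open>Id - L\<^sub>0\<close> maps the zero mass measures onto themselves
  (lemma \<open>resolvent_exists\<close>), which contain \<open>Lhat h\<close> as a strong limit of zero mass measures.
\<close>

section \<open>Norms on subspaces\<close>

context
  fixes B :: "'v::real_vector set" and N :: "'v \<Rightarrow> real"
  assumes norm: "norm_on B N"
begin

lemma norm_on_subspace: "subspace B"
  and norm_on_nonneg: "x \<in> B \<Longrightarrow> 0 \<le> N x"
  and norm_on_eq_0_iff: "x \<in> B \<Longrightarrow> N x = 0 \<longleftrightarrow> x = 0"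
  and norm_on_scaleR: "x \<in> B \<Longrightarrow> N (c *\<^sub>R x) = \<bar>c\<bar> * N x"
  and norm_on_triangle: "x \<in> B \<Longrightarrow> y \<in> B \<Longrightarrow> N (x + y) \<le> N x + N y"
  using norm by (simp_all add: norm_on_def)

lemma norm_on_zero: "N 0 = 0"
  using norm_on_eq_0_iff[OF subspace_0[OF norm_on_subspace]] by simp

lemma norm_on_minus: "x \<in> B \<Longrightarrow> N (- x) = N x"
  using norm_on_scaleR[of x "- 1"] by simp

lemma norm_on_triangle_diff: "x \<in> B \<Longrightarrow> y \<in> B \<Longrightarrow> N (x - y) \<le> N x + N y"
  using norm_on_triangle[of x "- y"] norm_on_minus[of y] subspace_neg[OF norm_on_subspace, of y]
  by simp

lemma norm_on_sum: "(\<And>i. i \<in> I \<Longrightarrow> f i \<in> B) \<Longrightarrow> N (\<Sum>i\<in>I. f i) \<le> (\<Sum>i\<in>I. N (f i))"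
proof (induction I rule: infinite_finite_induct)
  case (insert i I)
  then have "N (f i + (\<Sum>i\<in>I. f i)) \<le> N (f i) + N (\<Sum>i\<in>I. f i)"
    by (intro norm_on_triangle subspace_sum norm_on_subspace) auto
  with insert show ?case by force
qed (simp_all add: norm_on_zero)

lemma norm_on_mono: "subspace V \<Longrightarrow> V \<subseteq> B \<Longrightarrow> norm_on V N"
  using norm unfolding norm_on_def by (simp add: subset_iff)

lemma closed_in_norm_limit:
  assumes "closed_in_norm B N S" "x \<in> B"
    and "\<And>e. e > 0 \<Longrightarrow> \<exists>y\<in>S. N (y - x) < e"
  shows "x \<in> S"
proof (rule ccontr)
  assume "x \<notin> S"
  interpret Metric_space B "norm_dist B N"
    by (rule Metric_space_norm_dist[OF norm])
  obtain r where r: "r > 0" "disjnt S (mball x r)" and SB: "S \<subseteq> B"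
    using assms(1,2) \<open>x \<notin> S\<close> unfolding closed_in_norm_def closedin_metric by auto
  obtain y where y: "y \<in> S" "N (y - x) < r"
    using assms(3) r(1) by blast
  have "y \<in> mball x r"
    using y SB assms(2) by (subst in_mball, subst commute) (auto simp: norm_dist_def)
  with r(2) y(1) show False by (auto simp: disjnt_iff)
qed

end

lemma linear_funpow: "linear T \<Longrightarrow> linear (T ^^ n)"
  for T :: "'v::real_vector \<Rightarrow> 'v"
proof (induction n)
  case 0
  then show ?case using linear_id by (simp add: id_def)
next
  case (Suc n)
  then show ?case using linear_compose[of "T ^^ n" T] by (simp only: funpow.simps)
qed

text \<open>
  The supremum over the unit ball bounds every vector by rescaling. Definiteness of the norm \<open>p\<close>
  excludes nonzero vectors that cannot be rescaled to length one.
\<close>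

lemma op_norm_le_imp_bound:
  assumes E: "norm_on E p" and F: "norm_on F q" and T: "linear T" "T ` E \<subseteq> F"
    and K: "op_norm E p q T \<le> ereal K" and v: "v \<in> E"
  shows "q (T v) \<le> K * p v"
proof (cases "v = 0")
  case True
  then show ?thesis
    using norm_on_zero[OF E] norm_on_zero[OF F] linear_0[OF T(1)] by simp
next
  case False
  have pos: "p v > 0"
    using norm_on_nonneg[OF E v] norm_on_eq_0_iff[OF E v] False by simp
  let ?u = "(1 / p v) *\<^sub>R v"
  have "?u \<in> E" "p ?u \<le> 1"
    using pos v norm_on_scaleR[OF E v] subspace_scale[OF norm_on_subspace[OF E] v] by auto
  then have "ereal (q (T ?u)) \<le> op_norm E p q T"
    unfolding op_norm_def by (intro SUP_upper) auto
  then have "q (T ?u) \<le> K"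
    using K order_trans by fastforce
  moreover have "q (T ?u) = q (T v) / p v"
    using norm_on_scaleR[OF F, of "T v" "1 / p v"] T v pos by (auto simp: linear_scale)
  ultimately show ?thesis
    using pos by (simp add: divide_le_eq)
qed

section \<open>The resolvent at one of an operator with geometrically decaying powers\<close>

lemma neumann_telescope:
  fixes T :: "'v::real_vector \<Rightarrow> 'v"
  assumes "linear T"
  shows "(\<Sum>k<n. (T ^^ k) (x - T x)) = x - (T ^^ n) x"
proof (induction n)
  case (Suc n)
  then show ?case
    using linear_diff[OF linear_funpow[OF assms, of n], of x "T x"]
    by (simp add: funpow_swap1)
qed simp

text \<open>
  \<open>C\<close> may exceed \<open>1\<close>, so \<open>T\<close> may expand the norm; only its high powers are sure to contract.
\<close>

locale geometric_decay =
  fixes V :: "'v::real_vector set" and N :: "'v \<Rightarrow> real" and T :: "'v \<Rightarrow> 'v" and C r :: real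
  assumes norm: "norm_on V N" and linear: "linear T" and invariant: "T ` V \<subseteq> V"
    and C_pos: "0 < C" and r_pos: "0 < r" and r_less_1: "r < 1"
    and decay: "v \<in> V \<Longrightarrow> N ((T ^^ n) v) \<le> C * r ^ n * N v"
begin

lemmas subspace_V = norm_on_subspace[OF norm]

lemma funpow_in: "v \<in> V \<Longrightarrow> (T ^^ n) v \<in> V"
  using invariant by (induction n) auto

lemma sum_funpow_in: "v \<in> V \<Longrightarrow> (\<Sum>k<n. (T ^^ k) v) \<in> V"
  by (intro subspace_sum[OF subspace_V] funpow_in)

text \<open>
  The Neumann sums of \<open>x - T x\<close> telescope to \<open>x - T\<^sup>n x\<close>, hence recover \<open>x\<close> up to an error that
  vanishes as \<open>n\<close> grows, while their norms stay below a geometric series.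
\<close>

lemma resolvent_bound:
  assumes x: "x \<in> V"
  shows "N x \<le> C / (1 - r) * N (x - T x)"
proof -
  let ?f = "x - T x"
  have f: "?f \<in> V"
    using x invariant subspace_diff[OF subspace_V] by blast
  have "N x \<le> C / (1 - r) * N ?f + C * r ^ n * N x" for n
  proof -
    have "N (\<Sum>k<n. (T ^^ k) ?f) \<le> (\<Sum>k<n. N ((T ^^ k) ?f))"
      using f by (intro norm_on_sum[OF norm] funpow_in)
    also have "\<dots> \<le> (\<Sum>k<n. C * r ^ k * N ?f)"
      using f by (intro sum_mono decay)
    also have "\<dots> = C * N ?f * (\<Sum>k<n. r ^ k)"
      by (subst sum_distrib_left) (simp add: mult_ac)
    also have "\<dots> \<le> C * N ?f * (1 / (1 - r))"
    proof (rule mult_left_mono)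
      show "(\<Sum>k<n. r ^ k) \<le> 1 / (1 - r)"
        using r_pos r_less_1 by (simp add: sum_gp_strict divide_right_mono)
      show "0 \<le> C * N ?f"
        using C_pos norm_on_nonneg[OF norm f] by simp
    qed
    finally have "N (\<Sum>k<n. (T ^^ k) ?f) \<le> C / (1 - r) * N ?f"
      by (simp add: mult_ac)
    moreover have split: "(\<Sum>k<n. (T ^^ k) ?f) + (T ^^ n) x = x"
      by (simp add: neumann_telescope[OF linear])
    have "N x \<le> N (\<Sum>k<n. (T ^^ k) ?f) + N ((T ^^ n) x)"
      using norm_on_triangle[OF norm sum_funpow_in[OF f] funpow_in[OF x], of n n]
      unfolding split .
    ultimately show ?thesis
      using decay[OF x, of n] by linarith
  qed
  moreover have "(\<lambda>n. C / (1 - r) * N ?f + C * r ^ n * N x) \<longlonglongrightarrow> C / (1 - r) * N ?f + C * 0 * N x"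
    using r_pos r_less_1 by (intro tendsto_intros LIMSEQ_realpow_zero) auto
  ultimately show ?thesis
    using LIMSEQ_le_const by force
qed

text \<open>
  Cutting the Neumann series at \<open>n\<close> trades the two norms against each other: the head costs a
  factor \<open>n\<close> but sees only the weak norm \<open>P\<close> of \<open>x - T x\<close>, and the strong norm enters with a factor
  that decays in \<open>n\<close>.
\<close>

lemma weak_resolvent_bound:
  assumes P: "norm_on W P" and V_sub: "V \<subseteq> W" and weaker: "\<And>v. v \<in> V \<Longrightarrow> P v \<le> N v"
    and power_bounded: "\<And>v k. v \<in> V \<Longrightarrow> P ((T ^^ k) v) \<le> M * P v"
    and x: "x \<in> V"
  shows "P x \<le> n * (M * P (x - T x)) + C * r ^ n * (C / (1 - r) * N (x - T x))"
proof -
  let ?f = "x - T x"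
  have f: "?f \<in> V"
    using x invariant subspace_diff[OF subspace_V] by blast
  have "P (\<Sum>k<n. (T ^^ k) ?f) \<le> (\<Sum>k<n. P ((T ^^ k) ?f))"
    using f V_sub by (intro norm_on_sum[OF P]) (blast intro: funpow_in)
  also have "\<dots> \<le> (\<Sum>k<n. M * P ?f)"
    using f by (intro sum_mono power_bounded)
  finally have head: "P (\<Sum>k<n. (T ^^ k) ?f) \<le> n * (M * P ?f)"
    by simp
  have "P ((T ^^ n) x) \<le> C * r ^ n * N x"
    using weaker[OF funpow_in[OF x]] decay[OF x] by (rule order_trans)
  also have "\<dots> \<le> C * r ^ n * (C / (1 - r) * N ?f)"
    using C_pos r_pos by (intro mult_left_mono resolvent_bound x) simp
  finally have tail: "P ((T ^^ n) x) \<le> C * r ^ n * (C / (1 - r) * N ?f)" .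
  have split: "(\<Sum>k<n. (T ^^ k) ?f) + (T ^^ n) x = x"
    by (simp add: neumann_telescope[OF linear])
  have "P x \<le> P (\<Sum>k<n. (T ^^ k) ?f) + P ((T ^^ n) x)"
    using norm_on_triangle[OF P subsetD[OF V_sub sum_funpow_in[OF f]]
        subsetD[OF V_sub funpow_in[OF x]], of n n]
    unfolding split .
  with head tail show ?thesis by linarith
qed

text \<open>
  Some power \<open>T\<^sup>m\<close> is a strict contraction, so \<open>y \<mapsto> f + T\<^sup>m y\<close> has a fixed point, and applying
  \<open>Id + T + \<dots> + T\<^sup>m\<^sup>-\<^sup>1\<close> to it solves the equation for \<open>T\<close>, because that sum times \<open>Id - T\<close> is
  \<open>Id - T\<^sup>m\<close>.
\<close>

lemma resolvent_exists:
  assumes B: "banach_on B N" and closed: "closed_in_norm B N V" and f: "f \<in> V"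
  shows "\<exists>x\<in>V. x - T x = f"
proof -
  have VB: "V \<subseteq> B"
    using closedin_subset closed Metric_space.topspace_mtopology[OF Metric_space_norm_dist, of B N] B
    by (fastforce simp: closed_in_norm_def banach_on_def)
  interpret Submetric B "norm_dist B N" V
    using B VB Metric_space_norm_dist[of B N]
    by (simp add: banach_on_def Submetric_def Submetric_axioms_def)
  have complete: "sub.mcomplete"
    using closedin_mcomplete_imp_mcomplete B closed
    by (simp add: banach_on_def closed_in_norm_def)
  have "(\<lambda>n. C * r ^ n) \<longlonglongrightarrow> C * 0"
    using r_pos r_less_1 by (intro tendsto_intros LIMSEQ_realpow_zero) auto
  then have "\<forall>\<^sub>F n in sequentially. C * r ^ n < 1"
    by (rule order_tendstoD) simp
  then obtain m where m: "C * r ^ m < 1"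
    using eventually_happens'[OF sequentially_bot] by blast
  let ?S = "\<lambda>y. f + (T ^^ m) y"
  have S_in: "?S y \<in> V" if "y \<in> V" for y
    using that f by (intro subspace_add[OF subspace_V] funpow_in)
  have "norm_dist B N (?S x) (?S y) \<le> C * r ^ m * norm_dist B N x y"
    if xy: "x \<in> V" "y \<in> V" for x y
  proof -
    have "?S x - ?S y = (T ^^ m) (x - y)"
      by (simp add: linear_diff[OF linear_funpow[OF linear]])
    then show ?thesis
      using decay[OF subspace_diff[OF subspace_V xy], of m] xy VB S_in[OF xy(1)] S_in[OF xy(2)]
      by (auto simp: norm_dist_def)
  qed
  then obtain y where y: "y \<in> V" "?S y = y"
    using sub.Banach_fixedpoint_thm[OF complete, of ?S "C * r ^ m"] S_in f m by blast
  let ?x = "\<Sum>k<m. (T ^^ k) y"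
  have "?x - T ?x = (\<Sum>k<m. (T ^^ k) (y - T y))"
    by (simp add: linear_sum[OF linear] linear_diff[OF linear_funpow[OF linear]] sum_subtractf
        funpow_swap1)
  also have "\<dots> = y - (T ^^ m) y"
    by (rule neumann_telescope[OF linear])
  also have "\<dots> = f"
    using y(2) by (simp add: diff_eq_eq)
  finally show ?thesis
    using sum_funpow_in[OF y(1)] by blast
qed

end

section \<open>Zero mass\<close>

lemma mass_zero [simp]: "smeasure 0 A = 0"
  and mass_add [simp]: "smeasure (u + v) A = smeasure u A + smeasure v A"
  and mass_diff [simp]: "smeasure (u - v) A = smeasure u A - smeasure v A"
  and mass_scaleR [simp]: "smeasure (c *\<^sub>R v) A = c * smeasure v A"
  by (transfer; simp)+

lemma subspace_zero_mass: "subspace B \<Longrightarrow> subspace (zero_mass B)"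
  by (auto simp: subspace_def zero_mass_def)

text \<open>
  If \<open>c\<close> is the mass of \<open>T v\<close>, then \<open>T v - c *\<^sub>R p\<close> has zero mass, so its iterates
  \<open>T\<^sup>n\<^sup>+\<^sup>1 v - c *\<^sub>R p\<close> decay. As the iterates of \<open>v\<close> decay as well, \<open>c *\<^sub>R p\<close> must vanish.
\<close>

lemma invariant_of_decay:
  assumes B: "norm_on B N" and T: "linear T" "T ` B \<subseteq> B"
    and r: "0 < r" "r < 1"
    and decay: "\<And>v n. v \<in> zero_mass B \<Longrightarrow> N ((T ^^ n) v) \<le> C * r ^ n * N v"
    and p: "p \<in> B" "T p = p" "smeasure p UNIV = 1"
  shows "T ` zero_mass B \<subseteq> zero_mass B"
proof
  fix u assume "u \<in> T ` zero_mass B"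
  then obtain v where v: "v \<in> zero_mass B" "u = T v" by blast
  define c where "c = smeasure u UNIV"
  define w where "w = u - c *\<^sub>R p"
  have uB: "u \<in> B"
    using v T(2) by (auto simp: zero_mass_def)
  have cp: "c *\<^sub>R p \<in> B"
    using p(1) by (intro subspace_scale norm_on_subspace[OF B])
  have w: "w \<in> zero_mass B"
    using uB cp p(3) by (simp add: w_def c_def zero_mass_def subspace_diff[OF norm_on_subspace[OF B]])
  have pow_B: "(T ^^ n) x \<in> B" if "x \<in> B" for x n
    using that T(2) by (induction n) auto
  have "(T ^^ n) p = p" for n
    using p(2) by (induction n) auto
  then have pow: "c *\<^sub>R p = (T ^^ Suc n) v - (T ^^ n) w" for n
    using v(2)
    by (simp add: w_def linear_diff[OF linear_funpow[OF T(1)]]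
        linear_scale[OF linear_funpow[OF T(1)]] funpow_swap1)
  have "N (c *\<^sub>R p) \<le> C * r ^ Suc n * N v + C * r ^ n * N w" for n
  proof -
    have "N (c *\<^sub>R p) \<le> N ((T ^^ Suc n) v) + N ((T ^^ n) w)"
      unfolding pow[of n] using v(1) w
      by (intro norm_on_triangle_diff[OF B] pow_B) (auto simp: zero_mass_def)
    with decay[OF v(1), of "Suc n"] decay[OF w, of n] show ?thesis by linarith
  qed
  moreover have "(\<lambda>n. C * r ^ Suc n * N v + C * r ^ n * N w) \<longlonglongrightarrow> C * 0 * N v + C * 0 * N w"
    using r by (intro tendsto_intros LIMSEQ_realpow_zero LIMSEQ_Suc[of "\<lambda>n. r ^ n"]) auto
  ultimately have "N (c *\<^sub>R p) \<le> 0"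
    using LIMSEQ_le_const by force
  then have "c *\<^sub>R p = 0"
    using norm_on_nonneg[OF B cp] norm_on_eq_0_iff[OF B cp] by simp
  then have "c * smeasure p UNIV = 0"
    by (metis mass_scaleR mass_zero)
  then show "u \<in> zero_mass B"
    using uB p(3) by (simp add: c_def zero_mass_def)
qed

section \<open>Linear response\<close>

text \<open>
  The factor \<open>n\<close> is harmless because the bound holds for all \<open>n\<close> at each \<open>x\<close>: \<open>n\<close> can be fixed
  first, from the tail alone, and only then \<open>x\<close> moves along the filter.
\<close>

lemma tendsto_zero_of_head_tail_bound:
  fixes p g :: "'b \<Rightarrow> real"
  assumes bound: "\<forall>\<^sub>F x in F. \<forall>n::nat. 0 \<le> p x \<and> p x \<le> n * g x + K * r ^ n"
    and g: "(g \<longlongrightarrow> 0) F" and r: "0 < r" "r < 1"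
  shows "(p \<longlongrightarrow> 0) F"
proof (rule tendstoI)
  fix e :: real assume "e > 0"
  have "(\<lambda>n. K * r ^ n) \<longlonglongrightarrow> K * 0"
    using r by (intro tendsto_intros LIMSEQ_realpow_zero) auto
  then have "\<forall>\<^sub>F n in sequentially. K * r ^ n < e / 2"
    by (rule order_tendstoD) (simp add: \<open>e > 0\<close>)
  then obtain n where n: "K * r ^ n < e / 2"
    using eventually_happens'[OF sequentially_bot] by blast
  have "((\<lambda>x. n * g x) \<longlongrightarrow> real n * 0) F"
    using g by (intro tendsto_intros)
  then have "\<forall>\<^sub>F x in F. n * g x < e / 2"
    by (rule order_tendstoD) (simp add: \<open>e > 0\<close>)
  with bound show "\<forall>\<^sub>F x in F. dist (p x) 0 < e"
  proof eventually_elim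
    case (elim x)
    then have "0 \<le> p x" "p x \<le> n * g x + K * r ^ n" "n * g x < e / 2"
      by blast+
    with n show ?case by simp
  qed
qed

theorem proposition2p1:
  fixes Bss Bs Bw :: "'a::topological_space signed_measure set"
    and Nss Ns Nw :: "'a signed_measure \<Rightarrow> real"
    and L :: "real \<Rightarrow> 'a signed_measure \<Rightarrow> 'a signed_measure"
    and h :: "real \<Rightarrow> 'a signed_measure"
    and Lhat :: "'a signed_measure \<Rightarrow> 'a signed_measure"
    and hhat :: "'a signed_measure"
  assumes X: "compact_manifold_with_boundary (euclidean :: 'a topology)"
    and banach: "banach_on Bss Nss" "banach_on Bs Ns" "banach_on Bw Nw"
    and incl: "Bss \<subseteq> Bs" "Bs \<subseteq> Bw"
    and norms: "\<forall>v\<in>Bs. Nw v \<le> Ns v" "\<forall>v\<in>Bss. Ns v \<le> Nss v"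
    and closed: "closed_in_norm Bs Ns (zero_mass Bs)"
    and L_linear: "\<forall>\<epsilon>\<ge>0. linear (L \<epsilon>)"
    and L_positive: "\<forall>\<epsilon>\<ge>0. \<forall>\<mu>. positive_measure \<mu> \<longrightarrow> positive_measure (L \<epsilon> \<mu>)"
    and L_prob: "\<forall>\<epsilon>\<ge>0. \<forall>\<mu>. probability_measure \<mu> \<longrightarrow> probability_measure (L \<epsilon> \<mu>)"
    and L_acts: "\<forall>\<epsilon>\<ge>0. L \<epsilon> ` Bss \<subseteq> Bss \<and> L \<epsilon> ` Bs \<subseteq> Bs \<and> L \<epsilon> ` Bw \<subseteq> Bw"
    and h_fixed: "\<forall>\<epsilon>\<ge>0. probability_measure (h \<epsilon>) \<and> L \<epsilon> (h \<epsilon>) = h \<epsilon> \<and> h \<epsilon> \<in> Bss"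
    and h_unique: "\<forall>\<epsilon>\<ge>0. \<forall>\<mu>. probability_measure \<mu> \<and> L \<epsilon> \<mu> = \<mu> \<longrightarrow> \<mu> = h \<epsilon>"
    and A1: "\<exists>M::real. \<forall>k. op_norm Bw Nw Nw (L 0 ^^ k) \<le> ereal M \<and>
               (\<forall>\<epsilon>>0. op_norm Bw Nw Nw (L \<epsilon> ^^ k) \<le> ereal M)"
    and A2: "\<exists>C::real. \<forall>\<epsilon>\<ge>0. op_norm Bs Ns Nw (\<lambda>v. L \<epsilon> v - L 0 v) \<le> ereal (C * \<epsilon>)"
    and A3: "\<exists>C1 \<rho> :: real. 0 < C1 \<and> 0 < \<rho> \<and> \<rho> < 1 \<and>
               (\<forall>\<epsilon>\<ge>0. \<forall>n. op_norm (zero_mass Bs) Ns Ns (L \<epsilon> ^^ n) \<le> ereal (C1 * \<rho> ^ n))"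
    and Lhat_maps: "Lhat ` Bss \<subseteq> Bs"
    and A4: "((\<lambda>\<epsilon>. Ns ((1 / \<epsilon>) *\<^sub>R (L \<epsilon> (h 0) - L 0 (h 0)) - Lhat (h 0))) \<longlongrightarrow> 0) (at_right 0)"
    and hhat: "hhat = inv_into (zero_mass Bs) (\<lambda>v. v - L 0 v) (Lhat (h 0))"
  shows "((\<lambda>\<epsilon>. Nw ((1 / \<epsilon>) *\<^sub>R (h \<epsilon> - h 0) - hhat)) \<longlongrightarrow> 0) (at_right 0)"
proof -
  let ?V = "zero_mass Bs"
  have norm_s: "norm_on Bs Ns" and norm_w: "norm_on Bw Nw"
    using banach by (simp_all add: banach_on_def)
  note sub_s = norm_on_subspace[OF norm_s]
  have V_sub: "?V \<subseteq> Bs" by (auto simp: zero_mass_def)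
  have norm_V: "norm_on ?V Ns"
    using norm_on_mono[OF norm_s subspace_zero_mass[OF sub_s] V_sub] .
  note sub_V = norm_on_subspace[OF norm_V]
  have funpow_B: "(L \<epsilon> ^^ k) v \<in> B" if "L \<epsilon> ` B \<subseteq> B" "v \<in> B" for \<epsilon> k B v
    using that by (induction k) auto
  have h_mem: "h \<epsilon> \<in> Bs" and h_mass: "smeasure (h \<epsilon>) UNIV = 1" and h_fix: "L \<epsilon> (h \<epsilon>) = h \<epsilon>"
    if "\<epsilon> \<ge> 0" for \<epsilon>
    using h_fixed incl that by (auto simp: probability_measure_def)
  have L_s: "L \<epsilon> ` Bs \<subseteq> Bs" and L_w: "L \<epsilon> ` Bw \<subseteq> Bw" and lin: "linear (L \<epsilon>)"
    if "\<epsilon> \<ge> 0" for \<epsilon>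
    using L_acts L_linear that by auto

  obtain M where M: "\<And>\<epsilon> k. \<epsilon> \<ge> 0 \<Longrightarrow> op_norm Bw Nw Nw (L \<epsilon> ^^ k) \<le> ereal M"
    using A1 by (metis less_eq_real_def)
  have power_bounded: "Nw ((L \<epsilon> ^^ k) v) \<le> M * Nw v" if "\<epsilon> \<ge> 0" "v \<in> Bw" for \<epsilon> k v
    using funpow_B[OF L_w] that
    by (intro op_norm_le_imp_bound[OF norm_w norm_w linear_funpow[OF lin] _ M]) auto

  obtain C where C: "\<And>\<epsilon>. \<epsilon> \<ge> 0 \<Longrightarrow> op_norm Bs Ns Nw (\<lambda>v. L \<epsilon> v - L 0 v) \<le> ereal (C * \<epsilon>)"
    using A2 by blast
  have perturbation: "Nw (L \<epsilon> v - L 0 v) \<le> C * \<epsilon> * Ns v" if "\<epsilon> \<ge> 0" "v \<in> Bs" for \<epsilon> v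
  proof (rule op_norm_le_imp_bound[OF norm_s norm_w _ _ C that(2)])
    show "linear (\<lambda>v. L \<epsilon> v - L 0 v)"
      using that by (intro linear_compose_sub lin) auto
    show "(\<lambda>v. L \<epsilon> v - L 0 v) ` Bs \<subseteq> Bw"
      using L_s[OF that(1)] L_s[of 0] incl(2) subspace_diff[OF sub_s] by blast
  qed (use that in auto)

  obtain C1 \<rho> where C1: "0 < C1" and \<rho>: "0 < \<rho>" "\<rho> < 1"
    and A3': "\<And>\<epsilon> n. \<epsilon> \<ge> 0 \<Longrightarrow> op_norm ?V Ns Ns (L \<epsilon> ^^ n) \<le> ereal (C1 * \<rho> ^ n)"
    using A3 by blast
  have decay: "Ns ((L \<epsilon> ^^ n) v) \<le> C1 * \<rho> ^ n * Ns v" if "\<epsilon> \<ge> 0" "v \<in> ?V" for \<epsilon> n v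
    using funpow_B[OF L_s] V_sub that
    by (intro op_norm_le_imp_bound[OF norm_V norm_s linear_funpow[OF lin] _ A3']) auto
  have gd: "geometric_decay ?V Ns (L \<epsilon>) C1 \<rho>" if "\<epsilon> \<ge> 0" for \<epsilon>
  proof
    show "L \<epsilon> ` ?V \<subseteq> ?V"
      using invariant_of_decay[OF norm_s lin L_s \<rho> decay h_mem h_fix h_mass] that by blast
  qed (use norm_V linear_add[OF lin] linear_scale[OF lin] C1 \<rho> decay that in auto)
  note V_inv = geometric_decay.invariant[OF gd]

  \<comment> \<open>The two fixed point equations turn the difference quotient \<open>u\<close> of the fixed points into the
      difference quotient \<open>v\<close> of the operators at \<open>h 0\<close>, whose limit is known.\<close>
  define u where "u \<epsilon> = (1 / \<epsilon>) *\<^sub>R (h \<epsilon> - h 0)" for \<epsilon>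
  define v where "v \<epsilon> = (1 / \<epsilon>) *\<^sub>R (L \<epsilon> (h 0) - L 0 (h 0))" for \<epsilon>
  have u_mem: "u \<epsilon> \<in> ?V" if "\<epsilon> \<ge> 0" for \<epsilon>
    using h_mem[OF that] h_mem[of 0] h_mass[OF that] h_mass[of 0] sub_s
    by (simp add: u_def zero_mass_def subspace_diff subspace_scale)
  have u_eq: "u \<epsilon> - L \<epsilon> (u \<epsilon>) = v \<epsilon>" if "\<epsilon> \<ge> 0" for \<epsilon>
    using h_fix[OF that] h_fix[of 0]
    by (simp add: u_def v_def linear_scale[OF lin[OF that]] linear_diff[OF lin[OF that]]
        flip: scaleR_diff_right)
  have v_mem: "v \<epsilon> \<in> ?V" if "\<epsilon> \<ge> 0" for \<epsilon>
    using u_mem[OF that] V_inv[OF that] subspace_diff[OF sub_V] u_eq[OF that] by (metis image_subset_iff)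
  have v_lim: "((\<lambda>\<epsilon>. Ns (v \<epsilon> - Lhat (h 0))) \<longlongrightarrow> 0) (at_right 0)"
    using A4 by (simp add: v_def)
  have at_0: "\<forall>\<^sub>F \<epsilon> in at_right 0. (\<epsilon>::real) > 0"
    by (rule eventually_at_right_less)

  have Lhat_mem: "Lhat (h 0) \<in> ?V"
  proof (rule closed_in_norm_limit[OF norm_s closed])
    show "Lhat (h 0) \<in> Bs"
      using Lhat_maps h_fixed by blast
    fix e :: real assume "e > 0"
    then have "\<forall>\<^sub>F \<epsilon> in at_right 0. Ns (v \<epsilon> - Lhat (h 0)) < e"
      by (intro order_tendstoD(2)[OF v_lim])
    with at_0 have "\<forall>\<^sub>F \<epsilon> in at_right 0. \<epsilon> > 0 \<and> Ns (v \<epsilon> - Lhat (h 0)) < e"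
      by (rule eventually_conj)
    then obtain \<epsilon> where "\<epsilon> > 0" "Ns (v \<epsilon> - Lhat (h 0)) < e"
      using eventually_happens'[OF trivial_limit_at_right_real] by blast
    then show "\<exists>y\<in>?V. Ns (y - Lhat (h 0)) < e"
      using v_mem by (meson less_imp_le)
  qed
  have "Lhat (h 0) \<in> (\<lambda>v. v - L 0 v) ` ?V"
    using geometric_decay.resolvent_exists[OF gd banach(2) closed Lhat_mem] by force
  then have hhat_mem: "hhat \<in> ?V" and hhat_eq: "hhat - L 0 hhat = Lhat (h 0)"
    unfolding hhat by (rule inv_into_into, rule f_inv_into_f)

  define f where "f \<epsilon> = (v \<epsilon> - Lhat (h 0)) + (L \<epsilon> hhat - L 0 hhat)" for \<epsilon>
  have d_mem: "u \<epsilon> - hhat \<in> ?V" if "\<epsilon> \<ge> 0" for \<epsilon>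
    using u_mem[OF that] hhat_mem by (rule subspace_diff[OF sub_V])
  have d_eq: "(u \<epsilon> - hhat) - L \<epsilon> (u \<epsilon> - hhat) = f \<epsilon>" if "\<epsilon> \<ge> 0" for \<epsilon>
    unfolding f_def u_eq[OF that, symmetric] hhat_eq[symmetric]
    by (simp add: linear_diff[OF lin[OF that]])
  have first_mem: "v \<epsilon> - Lhat (h 0) \<in> ?V" and second_mem: "L \<epsilon> hhat - L 0 hhat \<in> ?V"
    if "\<epsilon> \<ge> 0" for \<epsilon>
    using v_mem[OF that] Lhat_mem hhat_mem V_inv[OF that] V_inv[of 0]
    by (auto intro!: subspace_diff[OF sub_V])

  have f_weak: "Nw (f \<epsilon>) \<le> Ns (v \<epsilon> - Lhat (h 0)) + C * \<epsilon> * Ns hhat" if "\<epsilon> \<ge> 0" for \<epsilon>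
  proof -
    have "Nw (f \<epsilon>) \<le> Nw (v \<epsilon> - Lhat (h 0)) + Nw (L \<epsilon> hhat - L 0 hhat)"
      unfolding f_def using first_mem[OF that] second_mem[OF that] V_sub incl(2)
      by (intro norm_on_triangle[OF norm_w]) auto
    moreover have "Nw (v \<epsilon> - Lhat (h 0)) \<le> Ns (v \<epsilon> - Lhat (h 0))"
      using norms(1) first_mem[OF that] V_sub by blast
    moreover have "Nw (L \<epsilon> hhat - L 0 hhat) \<le> C * \<epsilon> * Ns hhat"
      using hhat_mem V_sub that by (intro perturbation) auto
    ultimately show ?thesis by linarith
  qed
  have f_nonneg: "0 \<le> Nw (f \<epsilon>)" if "\<epsilon> \<ge> 0" for \<epsilon>
    unfolding f_def using first_mem[OF that] second_mem[OF that] V_sub incl(2)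
    by (intro norm_on_nonneg[OF norm_w] subspace_add norm_on_subspace[OF norm_w]) auto
  have f_lim: "((\<lambda>\<epsilon>. Nw (f \<epsilon>)) \<longlongrightarrow> 0) (at_right 0)"
  proof (rule tendsto_sandwich[OF _ _ tendsto_const])
    show "\<forall>\<^sub>F \<epsilon> in at_right 0. 0 \<le> Nw (f \<epsilon>)"
      using at_0 by eventually_elim (simp add: f_nonneg)
    show "\<forall>\<^sub>F \<epsilon> in at_right 0. Nw (f \<epsilon>) \<le> Ns (v \<epsilon> - Lhat (h 0)) + C * \<epsilon> * Ns hhat"
      using at_0 by eventually_elim (simp add: f_weak)
    have "((\<lambda>\<epsilon>. Ns (v \<epsilon> - Lhat (h 0)) + C * \<epsilon> * Ns hhat) \<longlongrightarrow> 0 + C * 0 * Ns hhat) (at_right 0)"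
      by (intro tendsto_intros v_lim)
    then show "((\<lambda>\<epsilon>. Ns (v \<epsilon> - Lhat (h 0)) + C * \<epsilon> * Ns hhat) \<longlongrightarrow> 0) (at_right 0)"
      by simp
  qed

  \<comment> \<open>\<open>1\<close> bounds the first summand of \<open>f\<close> near \<open>\<epsilon> = 0\<close>; the contraction bound for one iterate
      controls each of the two terms in the second summand.\<close>
  define S where "S = 1 + 2 * (C1 * \<rho> * Ns hhat)"
  have f_strong: "Ns (f \<epsilon>) \<le> S" if "\<epsilon> \<ge> 0" "Ns (v \<epsilon> - Lhat (h 0)) < 1" for \<epsilon>
  proof -
    have "Ns (f \<epsilon>) \<le> Ns (v \<epsilon> - Lhat (h 0)) + Ns (L \<epsilon> hhat - L 0 hhat)"
      unfolding f_def by (intro norm_on_triangle[OF norm_V] first_mem second_mem that)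
    also have "Ns (L \<epsilon> hhat - L 0 hhat) \<le> Ns (L \<epsilon> hhat) + Ns (L 0 hhat)"
      using V_inv[OF that(1)] V_inv[of 0] hhat_mem by (intro norm_on_triangle_diff[OF norm_V]) auto
    finally show ?thesis
      using decay[OF that(1) hhat_mem, of 1] decay[OF _ hhat_mem, of 0 1] that(2)
      by (simp add: S_def)
  qed

  have "((\<lambda>\<epsilon>. Nw (u \<epsilon> - hhat)) \<longlongrightarrow> 0) (at_right 0)"
  proof (rule tendsto_zero_of_head_tail_bound[OF _ _ \<rho>])
    show "((\<lambda>\<epsilon>. M * Nw (f \<epsilon>)) \<longlongrightarrow> 0) (at_right 0)"
      using tendsto_mult_left[OF f_lim, of M] by simp
    have "\<forall>\<^sub>F \<epsilon> in at_right 0. Ns (v \<epsilon> - Lhat (h 0)) < 1"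
      by (rule order_tendstoD(2)[OF v_lim]) simp
    with at_0 show "\<forall>\<^sub>F \<epsilon> in at_right 0. \<forall>n. 0 \<le> Nw (u \<epsilon> - hhat) \<and>
        Nw (u \<epsilon> - hhat) \<le> real n * (M * Nw (f \<epsilon>)) + (C1 * (C1 / (1 - \<rho>) * S)) * \<rho> ^ n"
    proof eventually_elim
      case (elim \<epsilon>)
      then have \<epsilon>: "\<epsilon> \<ge> 0" by simp
      interpret geometric_decay ?V Ns "L \<epsilon>" C1 \<rho> by (rule gd[OF \<epsilon>])
      show ?case
      proof (intro allI conjI)
        show "0 \<le> Nw (u \<epsilon> - hhat)"
          using d_mem[OF \<epsilon>] V_sub incl(2) by (intro norm_on_nonneg[OF norm_w]) auto
        fix n :: nat
        have "Nw (u \<epsilon> - hhat) \<le> n * (M * Nw (f \<epsilon>)) + C1 * \<rho> ^ n * (C1 / (1 - \<rho>) * Ns (f \<epsilon>))"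
          unfolding d_eq[OF \<epsilon>, symmetric]
          using V_sub incl(2) norms(1) power_bounded[OF \<epsilon>] d_mem[OF \<epsilon>]
          by (intro weak_resolvent_bound[OF norm_w]) auto
        also have "C1 * \<rho> ^ n * (C1 / (1 - \<rho>) * Ns (f \<epsilon>)) \<le> C1 * \<rho> ^ n * (C1 / (1 - \<rho>) * S)"
          using f_strong[OF \<epsilon> elim(2)] C1 \<rho> by (intro mult_left_mono) auto
        finally show "Nw (u \<epsilon> - hhat)
            \<le> n * (M * Nw (f \<epsilon>)) + (C1 * (C1 / (1 - \<rho>) * S)) * \<rho> ^ n"
          by (simp add: mult_ac)
      qed
    qed
  qed
  then show ?thesis
    by (simp add: u_def)
qed

end
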